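(* Let $0<a<b$ and $0<c<d$ be real numbers, let $\Delta=[a,b]\times[c,d]\subseteq(0,\infty)\times(0,\infty)$, and suppose that $f:\Delta\to\mathbb{R}$ is harmonically convex on the co-ordinates on $\Delta$. Then $$ \begin{aligned} f\left(\frac{2ab}{a+b},\frac{2cd}{c+d}\right) &\leq \frac{1}{2}\left[\frac{ab}{b-a}\int_{a}^{b}\frac{f\left(x,\frac{2cd}{c+d}\right)}{x^{2}}\,dx+\frac{cd}{d-c}\int_{c}^{d}\frac{f\left(\frac{2ab}{a+b},y\right)}{y^{2}}\,dy\right]\\ &\leq \frac{abcd}{(b-a)(d-c)}\int_{a}^{b}\int_{c}^{d}\frac{f(x,y)}{(xy)^{2}}\,dy\,dx\\ &\leq \frac{1}{4}\left[\frac{ab}{b-a}\int_{a}^{b}\frac{f(x,c)}{x^{2}}\,dx+\frac{ab}{b-a}\int_{a}^{b}\frac{f(x,d)}{x^{2}}\,dx+\frac{cd}{d-c}\int_{c}^{d}\frac{f(a,y)}{y^{2}}\,dy+\frac{cd}{d-c}\int_{c}^{d}\frac{f(b,y)}{y^{2}}\,dy\right]\\ &\leq \frac{f(a,c)+f(a,d)+f(b,c)+f(b,d)}{4}. \end{aligned} $$ The four inequalities in this chain are sharp, in the sense that there is a function $f$ that is harmonically convex on the co-ordinates on $\Delta$ for which all of them hold with equality.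
   Context: A function $g:I\to\mathbb{R}$ on a real interval $I\subset\mathbb{R}\setminus\{0\}$ is harmonically convex if $g\left(\frac{xy}{tx+(1-t)y}\right)\leq t\,g(y)+(1-t)\,g(x)$ for all $x,y\in I$ and $t\in[0,1]$. For $\Delta=[a,b]\times[c,d]\subseteq(0,\infty)\times(0,\infty)$ with $a<b$, $c<d$, a function $f:\Delta\to\mathbb{R}$ is harmonically convex on the co-ordinates (on $\Delta$) if for every $y\in[c,d]$ the partial mapping $f_y:[a,b]\to\mathbb{R}$, $f_y(u)=f(u,y)$, is harmonically convex and for every $x\in[a,b]$ the partial mapping $f_x:[c,d]\to\mathbb{R}$, $f_x(v)=f(x,v)$, is harmonically convex. *)

theory Defs
  imports "HOL-Analysis.Analysis"
begin

definition harmonically_convex_on :: "real set \<Rightarrow> (real \<Rightarrow> real) \<Rightarrow> bool" where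
  "harmonically_convex_on I g \<longleftrightarrow>
     is_interval I \<and> 0 \<notin> I \<and>
     (\<forall>x\<in>I. \<forall>y\<in>I. \<forall>t\<in>{0..1}.
        g (x * y / (t * x + (1 - t) * y)) \<le> t * g y + (1 - t) * g x)"

(* The rectangle is {a..b} \<times> {c..d}; values of f outside it are irrelevant. *)
definition harmonically_convex_on_coordinates ::
    "real \<Rightarrow> real \<Rightarrow> real \<Rightarrow> real \<Rightarrow> (real \<times> real \<Rightarrow> real) \<Rightarrow> bool" where
  "harmonically_convex_on_coordinates a b c d f \<longleftrightarrow>
     (\<forall>y\<in>{c..d}. harmonically_convex_on {a..b} (\<lambda>u. f (u, y))) \<and>
     (\<forall>x\<in>{a..b}. harmonically_convex_on {c..d} (\<lambda>v. f (x, v)))"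

end

theory Submission
  imports Defs
begin

text \<open>
  In the variable \<open>1/x\<close> a harmonically convex function is convex, and \<open>dx/x\<^sup>2\<close> is Lebesgue measure.
  Its chord and a supporting line at the midpoint therefore bound it from above and below, and
  integrating them gives the one-dimensional Hermite-Hadamard inequality.
  In two variables, \<open>F x = \<integral> f (x, y) / y\<^sup>2 dy\<close> is again harmonically convex, so every
  inequality follows from the one-dimensional case applied either to a partial mapping or to \<open>F\<close>;
  the order of integration never has to be exchanged.
\<close>

section \<open>One variable: the reciprocal substitution, affine bounds, Hermite-Hadamard\<close>

lemma harmonically_convex_onD:
  assumes "harmonically_convex_on I g" "x \<in> I" "y \<in> I" "t \<in> {0..1}"
  shows "g (x * y / (t * x + (1 - t) * y)) \<le> t * g y + (1 - t) * g x"
  using assms unfolding harmonically_convex_on_def by blast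

text \<open>Reciprocals turn weighted harmonic means into weighted arithmetic means. This makes the
  theory of convex functions, with its support lines and its continuity in the interior, available
  for \<open>g\<close>.\<close>

lemma harmonically_convex_on_imp_convex_on:
  assumes g: "harmonically_convex_on {a..b} g" and ab: "0 < a" "a < b"
  shows "convex_on {1/b..1/a} (\<lambda>s. g (1/s))"
proof (rule convex_onI)
  fix t s r :: real
  assume t: "0 < t" "t < 1" and s: "s \<in> {1/b..1/a}" and r: "r \<in> {1/b..1/a}"
  have "0 < 1/b" using ab by simp
  then have pos: "0 < s" "0 < r" using s r unfolding atLeastAtMost_iff by linarith+
  have inv: "1/s \<in> {a..b}" "1/r \<in> {a..b}"
    using s r pos ab by (auto simp: field_simps)
  have "0 < (1 - t) * s + t * r"
    using pos t by (simp add: add_pos_pos)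
  then have "(1/s) * (1/r) / (t * (1/s) + (1 - t) * (1/r)) = 1 / ((1 - t) * s + t * r)"
    using pos by (simp add: divide_simps)
  moreover have "g ((1/s) * (1/r) / (t * (1/s) + (1 - t) * (1/r)))
    \<le> t * g (1/r) + (1 - t) * g (1/s)"
    using t by (intro harmonically_convex_onD[OF g] inv) simp
  ultimately show "g (1 / ((1 - t) *\<^sub>R s + t *\<^sub>R r)) \<le> (1 - t) * g (1/s) + t * g (1/r)"
    by simp
qed simp

text \<open>The support line and the chord, both written in the variable \<open>1/x\<close> and
  centred at \<open>(a + b)/(2*a*b)\<close>, the midpoint of \<open>{1/b..1/a}\<close>. With this
  centring the slope terms integrate to zero against \<open>dx/x^2\<close>, so only the existence of
  \<open>B\<close> and \<open>C\<close> matters later.\<close>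

lemma harmonically_convex_on_bounds:
  assumes g: "harmonically_convex_on {a..b} g" and ab: "0 < a" "a < b"
  obtains B C where
    "\<And>x. x \<in> {a..b} \<Longrightarrow> g (2*a*b/(a + b)) + B * (1/x - (a + b)/(2*a*b)) \<le> g x"
    "\<And>x. x \<in> {a..b} \<Longrightarrow> g x \<le> (g a + g b)/2 + C * (1/x - (a + b)/(2*a*b))"
proof
  let ?m = "(a + b)/(2*a*b)"
  \<comment> \<open>The right derivative of \<open>g (1/s)\<close> at the midpoint, as the infimum
    of the difference quotients to its right.\<close>
  let ?B = "Inf ((\<lambda>t. (g (1/?m) - g (1/t)) / (?m - t)) ` ({?m<..} \<inter> {1/b..1/a}))"
  have m: "?m \<in> interior {1/b..1/a}"
    using ab by (simp add: field_simps)
  fix x assume x: "x \<in> {a..b}"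
  have "1/x \<in> {1/b..1/a}" using x ab by (auto simp: field_simps)
  from convex_le_Inf_differential[OF harmonically_convex_on_imp_convex_on[OF g ab] m this]
  show "g (2*a*b/(a + b)) + ?B * (1/x - ?m) \<le> g x"
    by simp
next
  \<comment> \<open>Slope of the chord in the variable \<open>1/x\<close>, since
    \<open>1/a - 1/b = (b - a)/(a*b)\<close>.\<close>
  let ?C = "(g a - g b) * (a*b/(b - a))"
  fix x assume x: "x \<in> {a..b}"
  \<comment> \<open>The solution of \<open>1/x = t/a + (1 - t)/b\<close>, which presents
    \<open>x\<close> as a weighted harmonic mean of the endpoints.\<close>
  define t where "t = a * (b - x) / (x * (b - a))"
  have "a * (b - x) \<le> x * (b - a)"
    using x ab mult_left_mono[of a x b] by (auto simp: algebra_simps)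
  then have t: "t \<in> {0..1}" using x ab by (auto simp: t_def field_simps)
  have "t * (b - a) = a * (b - x) / x"
    using x ab by (simp add: t_def)
  then have "t * b + (1 - t) * a = a * b / x"
    using x ab by (simp add: field_simps)
  then have "b * a / (t * b + (1 - t) * a) = x"
    using x ab by simp
  moreover have "g (b * a / (t * b + (1 - t) * a)) \<le> t * g a + (1 - t) * g b"
    using ab by (intro harmonically_convex_onD[OF g] t) simp_all
  moreover have "t * g a + (1 - t) * g b = (g a + g b)/2 + ?C * (1/x - (a + b)/(2*a*b))"
  proof -
    have "t = 1/2 + (a*b/(b - a)) * (1/x - (a + b)/(2*a*b))"
      using x ab by (simp add: t_def divide_simps) (simp add: algebra_simps)
    \<comment> \<open>Stated for arbitrary \<open>k\<close> and \<open>e\<close>, so that the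
      simplifier treats the fractions as atoms.\<close>
    moreover have "t * u + (1 - t) * v = (u + v)/2 + ((u - v) * k) * e"
      if "t = 1/2 + k * e" for k e u v :: real
      unfolding that by (simp add: field_simps)
    ultimately show ?thesis by blast
  qed
  ultimately show "g x \<le> (g a + g b)/2 + ?C * (1/x - (a + b)/(2*a*b))"
    by simp
qed

text \<open>Under \<open>dx/x^2\<close> the interval has mass
  \<open>1/a - 1/b = (b - a)/(a*b)\<close>, and \<open>1/x\<close> has mean
  \<open>(a + b)/(2*a*b)\<close>. Hence the term with \<open>B\<close> vanishes.\<close>

lemma has_integral_harmonic_affine:
  fixes a b A B :: real
  assumes "0 < a" "a < b"
  shows "((\<lambda>x. (A + B * (1/x - (a + b)/(2*a*b))) / x^2) has_integral A * ((b - a)/(a*b))) {a..b}"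
proof -
  let ?m = "(a + b)/(2*a*b)"
  let ?P = "\<lambda>x. - (A - B * ?m) / x - B / (2 * x^2)"
  have deriv: "((\<lambda>x. - (A - B * m) / x - B / (2 * x^2)) has_real_derivative (A + B * (1/x - m)) / x^2)
    (at x within {a..b})" if "x > 0" for x m :: real
    using that
    by (auto intro!: derivative_eq_intros) (simp add: field_simps power2_eq_square power4_eq_xxxx)
  have "((\<lambda>x. (A + B * (1/x - ?m)) / x^2) has_integral ?P b - ?P a) {a..b}"
  proof (rule fundamental_theorem_of_calculus)
    fix x assume "x \<in> {a..b}"
    then show "(?P has_vector_derivative (A + B * (1/x - ?m)) / x^2) (at x within {a..b})"
      unfolding has_real_derivative_iff_has_vector_derivative[symmetric]
      using assms by (intro deriv) simp
  qed (use assms in simp)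
  moreover have "?P b - ?P a = A * ((b - a)/(a*b))"
    using assms by (simp add: divide_simps power2_eq_square) (simp add: algebra_simps)
  ultimately show ?thesis by simp
qed

text \<open>Convexity gives continuity only inside the interval; \<open>g\<close> may jump at the
  endpoints. So measurability is taken on the open interval, the affine bounds supply domination,
  and the two endpoints do not affect integrability.\<close>

lemma harmonically_convex_on_integrable:
  assumes g: "harmonically_convex_on {a..b} g" and ab: "0 < a" "a < b"
  shows "(\<lambda>x. g x / x^2) integrable_on {a..b}"
proof -
  obtain B C where
    lo: "\<And>x. x \<in> {a..b} \<Longrightarrow> g (2*a*b/(a + b)) + B * (1/x - (a + b)/(2*a*b)) \<le> g x" and
    up: "\<And>x. x \<in> {a..b} \<Longrightarrow> g x \<le> (g a + g b)/2 + C * (1/x - (a + b)/(2*a*b))"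
    using harmonically_convex_on_bounds[OF g ab] by metis
  let ?l = "\<lambda>x. (g (2*a*b/(a + b)) + B * (1/x - (a + b)/(2*a*b))) / x^2"
  let ?u = "\<lambda>x. ((g a + g b)/2 + C * (1/x - (a + b)/(2*a*b))) / x^2"
  have "convex_on {1/b<..<1/a} (\<lambda>s. g (1/s))"
    using harmonically_convex_on_imp_convex_on[OF g ab]
    by (rule convex_on_subset) auto
  then have "continuous_on {1/b<..<1/a} (\<lambda>s. g (1/s))"
    by (rule convex_on_continuous[rotated]) simp
  then have "continuous_on {a<..<b} (\<lambda>x. g (1/(1/x)))"
    by (rule continuous_on_compose2) (use ab in \<open>auto intro!: continuous_intros simp: field_simps\<close>)
  then have "continuous_on {a<..<b} (\<lambda>x. g x / x^2)"
    using ab by (intro continuous_intros) auto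
  then have meas: "(\<lambda>x. g x / x^2) \<in> borel_measurable (lebesgue_on {a<..<b})"
    by (rule continuous_imp_measurable_on_sets_lebesgue) simp
  \<comment> \<open>The dominating function: anything between \<open>?l x\<close> and
    \<open>?u x\<close> has absolute value at most this sum.\<close>
  have cont: "continuous_on {a..b} (\<lambda>x. \<bar>?l x\<bar> + \<bar>?u x\<bar>)"
    using ab by (intro continuous_intros) auto
  then have "(\<lambda>x. \<bar>?l x\<bar> + \<bar>?u x\<bar>) integrable_on {a<..<b}"
    unfolding integrable_on_open_interval_real by (rule integrable_continuous_real)
  moreover have "\<bar>g x / x^2\<bar> \<le> \<bar>?l x\<bar> + \<bar>?u x\<bar>" if "x \<in> {a<..<b}" for x
  proof -
    have "?l x \<le> g x / x^2" "g x / x^2 \<le> ?u x"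
      using lo[of x] up[of x] that by (auto intro: divide_right_mono)
    then show ?thesis by linarith
  qed
  ultimately have "(\<lambda>x. g x / x^2) integrable_on {a<..<b}"
    using measurable_bounded_by_integrable_imp_integrable[OF meas] by simp
  then show ?thesis unfolding integrable_on_open_interval_real .
qed

text \<open>Integrating the two affine bounds kills their slope terms and leaves the value at the
  harmonic mean below and the average of the end values above.\<close>

lemma harmonic_hermite_hadamard:
  assumes g: "harmonically_convex_on {a..b} g" and ab: "0 < a" "a < b"
  shows "g (2*a*b/(a + b)) \<le> a*b/(b - a) * integral {a..b} (\<lambda>x. g x / x^2)"
    and "a*b/(b - a) * integral {a..b} (\<lambda>x. g x / x^2) \<le> (g a + g b)/2"
proof -
  obtain B C where
    lo: "\<And>x. x \<in> {a..b} \<Longrightarrow> g (2*a*b/(a + b)) + B * (1/x - (a + b)/(2*a*b)) \<le> g x" and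
    up: "\<And>x. x \<in> {a..b} \<Longrightarrow> g x \<le> (g a + g b)/2 + C * (1/x - (a + b)/(2*a*b))"
    using harmonically_convex_on_bounds[OF g ab] by metis
  note I = integrable_integral[OF harmonically_convex_on_integrable[OF g ab]]
  have "g (2*a*b/(a + b)) * ((b - a)/(a*b)) \<le> integral {a..b} (\<lambda>x. g x / x^2)"
    by (rule has_integral_le[OF has_integral_harmonic_affine[OF ab, where B = B] I])
      (use lo in \<open>auto intro: divide_right_mono\<close>)
  then show "g (2*a*b/(a + b)) \<le> a*b/(b - a) * integral {a..b} (\<lambda>x. g x / x^2)"
    using ab by (simp add: field_simps)
  have "integral {a..b} (\<lambda>x. g x / x^2) \<le> (g a + g b)/2 * ((b - a)/(a*b))"
    by (rule has_integral_le[OF I has_integral_harmonic_affine[OF ab, where B = C]])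
      (use up in \<open>auto intro: divide_right_mono\<close>)
  then show "a*b/(b - a) * integral {a..b} (\<lambda>x. g x / x^2) \<le> (g a + g b)/2"
    using ab by (simp add: field_simps)
qed

section \<open>Two variables: averaging in one coordinate, then in the other\<close>

lemma harmonic_mean_mem:
  fixes a b x y t :: real
  assumes "0 < a" and x: "x \<in> {a..b}" and y: "y \<in> {a..b}" and t: "t \<in> {0..1}"
  shows "x * y / (t * x + (1 - t) * y) \<in> {a..b}"
proof -
  have "0 < t * x + (1 - t) * y"
    \<comment> \<open>\<open>convex_bound_lt\<close> gives upper bounds, so it is applied to the
      negated points.\<close>
    using assms convex_bound_lt[of "- x" 0 "- y" t "1 - t"] by simp
  moreover have "t * (x * a) \<le> t * (x * y)" "(1 - t) * (y * a) \<le> (1 - t) * (y * x)"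
    "t * (x * y) \<le> t * (x * b)" "(1 - t) * (y * x) \<le> (1 - t) * (y * b)"
    using assms by (auto intro!: mult_left_mono)
  then have "a * (t * x + (1 - t) * y) \<le> x * y" "x * y \<le> b * (t * x + (1 - t) * y)"
    by (simp_all add: algebra_simps)
  ultimately show ?thesis by (simp add: pos_le_divide_eq pos_divide_le_eq)
qed

text \<open>For each fixed second coordinate the convexity inequality in \<open>x\<close> holds with
  the same weights, and integration preserves it. Convexity in the second coordinate makes every
  slice integrable, including the one at the harmonic mean.\<close>

lemma harmonically_convex_on_integral:
  assumes f: "harmonically_convex_on_coordinates a b c d f" and ab: "0 < a" and cd: "0 < c" "c < d"
  shows "harmonically_convex_on {a..b} (\<lambda>x. integral {c..d} (\<lambda>y. f (x, y) / y^2))"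
  unfolding harmonically_convex_on_def
proof (intro conjI ballI)
  have fx: "harmonically_convex_on {a..b} (\<lambda>u. f (u, y))" if "y \<in> {c..d}" for y
    using f that by (simp add: harmonically_convex_on_coordinates_def)
  have int: "(\<lambda>y. f (x, y) / y^2) integrable_on {c..d}" if "x \<in> {a..b}" for x
    using f that assms
    by (intro harmonically_convex_on_integrable) (auto simp: harmonically_convex_on_coordinates_def)
  show "is_interval {a..b}" by (rule is_interval_cc)
  show "0 \<notin> {a..b}" using ab by simp
  fix x y t :: real
  assume x: "x \<in> {a..b}" and y: "y \<in> {a..b}" and t: "t \<in> {0..1}"
  let ?z = "x * y / (t * x + (1 - t) * y)"
  let ?F = "\<lambda>x. integral {c..d} (\<lambda>y. f (x, y) / y^2)"
  have z: "?z \<in> {a..b}" by (rule harmonic_mean_mem[OF ab x y t])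
  have "?F ?z \<le> integral {c..d} (\<lambda>v. t * (f (y, v) / v^2) + (1 - t) * (f (x, v) / v^2))"
  proof (rule integral_le)
    show "(\<lambda>v. t * (f (y, v) / v^2) + (1 - t) * (f (x, v) / v^2)) integrable_on {c..d}"
      by (intro integrable_add integrable_on_mult_right int x y)
    fix v assume "v \<in> {c..d}"
    then have "f (?z, v) \<le> t * f (y, v) + (1 - t) * f (x, v)"
      by (intro harmonically_convex_onD[OF fx] x y t)
    then have "f (?z, v) / v^2 \<le> (t * f (y, v) + (1 - t) * f (x, v)) / v^2"
      by (rule divide_right_mono) simp
    then show "f (?z, v) / v^2 \<le> t * (f (y, v) / v^2) + (1 - t) * (f (x, v) / v^2)"
      by (simp add: add_divide_distrib)
  qed (rule int[OF z])
  also have "\<dots> = t * ?F y + (1 - t) * ?F x"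
    by (simp only: integral_add integrable_on_mult_right int x y integral_mult_right)
  finally show "?F ?z \<le> t * ?F y + (1 - t) * ?F x" .
qed

text \<open>\<open>H v\<close> and \<open>V u\<close> are the normalised averages of
  \<open>f\<close> along a horizontal and a vertical segment, and \<open>J\<close> is its average
  over the rectangle. Each inequality combines one-dimensional bounds for the two
  directions.\<close>

lemma harmonic_hermite_hadamard_coordinates:
  fixes a b c d :: real
  assumes f: "harmonically_convex_on_coordinates a b c d f"
    and ab: "0 < a" "a < b" and cd: "0 < c" "c < d"
  defines "p \<equiv> 2*a*b/(a + b)" and "q \<equiv> 2*c*d/(c + d)"
  defines "H \<equiv> \<lambda>v. a*b/(b - a) * integral {a..b} (\<lambda>x. f (x, v) / x^2)"
    and "V \<equiv> \<lambda>u. c*d/(d - c) * integral {c..d} (\<lambda>y. f (u, y) / y^2)"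
    and "J \<equiv> a*b*c*d/((b - a)*(d - c))
      * integral {a..b} (\<lambda>x. integral {c..d} (\<lambda>y. f (x, y) / (x*y)^2))"
  shows "f (p, q) \<le> 1/2 * (H q + V p)"
    and "1/2 * (H q + V p) \<le> J"
    and "J \<le> 1/4 * (H c + H d + V a + V b)"
    and "1/4 * (H c + H d + V a + V b) \<le> (f (a, c) + f (a, d) + f (b, c) + f (b, d)) / 4"
proof -
  let ?F = "\<lambda>x. integral {c..d} (\<lambda>y. f (x, y) / y^2)"
  have fx: "harmonically_convex_on {a..b} (\<lambda>u. f (u, y))" if "y \<in> {c..d}" for y
    using f that by (simp add: harmonically_convex_on_coordinates_def)
  have fy: "harmonically_convex_on {c..d} (\<lambda>v. f (x, v))" if "x \<in> {a..b}" for x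
    using f that by (simp add: harmonically_convex_on_coordinates_def)
  have p: "p \<in> {a..b}"
    using ab harmonic_mean_mem[of a a b b "1/2"] by (simp add: p_def field_simps)
  have q: "q \<in> {c..d}"
    using cd harmonic_mean_mem[of c c d d "1/2"] by (simp add: q_def field_simps)
  have Hlo: "f (p, v) \<le> H v" and Hup: "H v \<le> (f (a, v) + f (b, v))/2" if "v \<in> {c..d}" for v
    using harmonic_hermite_hadamard[OF fx[OF that] ab] by (simp_all add: H_def p_def)
  have Vlo: "f (u, q) \<le> V u" and Vup: "V u \<le> (f (u, c) + f (u, d))/2" if "u \<in> {a..b}" for u
    using harmonic_hermite_hadamard[OF fy[OF that] cd] by (simp_all add: V_def q_def)
  note F = harmonically_convex_on_integral[OF f ab(1) cd]
  have pos: "0 < a*b/(b - a)" "0 < c*d/(d - c)" using ab cd by simp_all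
  have "(\<lambda>x. integral {c..d} (\<lambda>y. f (x, y) / (x*y)^2)) = (\<lambda>x. ?F x / x^2)"
    unfolding integral_divide[symmetric] by (simp add: power_mult_distrib mult.commute)
  then have J: "J = c*d/(d - c) * (a*b/(b - a) * integral {a..b} (\<lambda>x. ?F x / x^2))"
    by (simp add: J_def mult_ac)
  \<comment> \<open>\<open>J\<close> is the average of \<open>V\<close>, so pointwise bounds on
    \<open>V\<close> integrate to bounds on \<open>J\<close>.\<close>
  have J_V: "J = a*b/(b - a) * integral {a..b} (\<lambda>x. V x / x^2)"
    by (simp add: J V_def times_divide_eq_right[symmetric] del: times_divide_eq_right)
  have V_int: "(\<lambda>x. V x / x^2) integrable_on {a..b}"
    using integrable_on_mult_right[OF harmonically_convex_on_integrable[OF F ab], of "c*d/(d - c)"]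
    by (simp add: V_def)
  have f_int: "(\<lambda>x. f (x, v) / x^2) integrable_on {a..b}" if "v \<in> {c..d}" for v
    by (rule harmonically_convex_on_integrable[OF fx[OF that] ab])
  \<comment> \<open>The bounds by \<open>V\<close> are Hermite-Hadamard for the inner integral
    \<open>?F\<close>, rescaled by \<open>c*d/(d - c)\<close>.\<close>
  have "V p \<le> J"
    using mult_left_mono[OF harmonic_hermite_hadamard(1)[OF F ab] less_imp_le[OF pos(2)]]
    by (simp only: J V_def p_def)
  moreover have "J \<le> (V a + V b)/2"
    using mult_left_mono[OF harmonic_hermite_hadamard(2)[OF F ab] less_imp_le[OF pos(2)]]
    by (simp only: J V_def) (simp add: algebra_simps add_divide_distrib)
  \<comment> \<open>The bounds by \<open>H\<close> come instead from integrating \<open>Vlo\<close>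
    and \<open>Vup\<close> over \<open>x\<close>, which keeps the order of integration.\<close>
  moreover have "H q \<le> J"
    unfolding H_def J_V
    by (intro mult_left_mono integral_le divide_right_mono Vlo V_int f_int q) (use pos in auto)
  moreover have "J \<le> (H c + H d)/2"
  proof -
    have "J \<le> a*b/(b - a) * integral {a..b} (\<lambda>x. (f (x, c) / x^2 + f (x, d) / x^2) / 2)"
      unfolding J_V
    proof (intro mult_left_mono integral_le V_int)
      show "(\<lambda>x. (f (x, c) / x^2 + f (x, d) / x^2) / 2) integrable_on {a..b}"
        using cd by (intro integrable_on_divide integrable_add f_int) auto
      show "V x / x^2 \<le> (f (x, c) / x^2 + f (x, d) / x^2) / 2" if "x \<in> {a..b}" for x
        using divide_right_mono[OF Vup[OF that], of "x^2"] by (simp add: add_divide_distrib)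
    qed (use pos in simp)
    also have "\<dots> = (H c + H d)/2"
      using cd by (simp add: H_def integral_add f_int distrib_left)
    finally show ?thesis .
  qed
  ultimately show "1/2 * (H q + V p) \<le> J" "J \<le> 1/4 * (H c + H d + V a + V b)"
    by (simp_all add: field_simps)
  show "f (p, q) \<le> 1/2 * (H q + V p)"
    using Hlo[OF q] Vlo[OF p] by simp
  show "1/4 * (H c + H d + V a + V b) \<le> (f (a, c) + f (a, d) + f (b, c) + f (b, d)) / 4"
    using Hup[of c] Hup[of d] Vup[of a] Vup[of b] ab cd by (simp add: field_simps)
qed

theorem theorem3:
  fixes a b c d :: real
  assumes "0 < a" and "a < b" and "0 < c" and "c < d"
  shows "(\<forall>f :: real \<times> real \<Rightarrow> real. harmonically_convex_on_coordinates a b c d f \<longrightarrow>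
         f (2*a*b/(a + b), 2*c*d/(c + d))
         \<le> 1/2 * (a*b/(b - a) * integral {a..b} (\<lambda>x. f (x, 2*c*d/(c + d)) / x^2)
             + c*d/(d - c) * integral {c..d} (\<lambda>y. f (2*a*b/(a + b), y) / y^2))
       \<and> 1/2 * (a*b/(b - a) * integral {a..b} (\<lambda>x. f (x, 2*c*d/(c + d)) / x^2)
             + c*d/(d - c) * integral {c..d} (\<lambda>y. f (2*a*b/(a + b), y) / y^2))
         \<le> a*b*c*d/((b - a)*(d - c))
           * integral {a..b} (\<lambda>x. integral {c..d} (\<lambda>y. f (x, y) / (x*y)^2))
       \<and> a*b*c*d/((b - a)*(d - c))
           * integral {a..b} (\<lambda>x. integral {c..d} (\<lambda>y. f (x, y) / (x*y)^2))
         \<le> 1/4 * (a*b/(b - a) * integral {a..b} (\<lambda>x. f (x, c) / x^2)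
             + a*b/(b - a) * integral {a..b} (\<lambda>x. f (x, d) / x^2)
             + c*d/(d - c) * integral {c..d} (\<lambda>y. f (a, y) / y^2)
             + c*d/(d - c) * integral {c..d} (\<lambda>y. f (b, y) / y^2))
       \<and> 1/4 * (a*b/(b - a) * integral {a..b} (\<lambda>x. f (x, c) / x^2)
             + a*b/(b - a) * integral {a..b} (\<lambda>x. f (x, d) / x^2)
             + c*d/(d - c) * integral {c..d} (\<lambda>y. f (a, y) / y^2)
             + c*d/(d - c) * integral {c..d} (\<lambda>y. f (b, y) / y^2))
         \<le> (f (a, c) + f (a, d) + f (b, c) + f (b, d)) / 4)
    \<and> (\<exists>f :: real \<times> real \<Rightarrow> real. harmonically_convex_on_coordinates a b c d f
       \<and> f (2*a*b/(a + b), 2*c*d/(c + d))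
         = 1/2 * (a*b/(b - a) * integral {a..b} (\<lambda>x. f (x, 2*c*d/(c + d)) / x^2)
             + c*d/(d - c) * integral {c..d} (\<lambda>y. f (2*a*b/(a + b), y) / y^2))
       \<and> 1/2 * (a*b/(b - a) * integral {a..b} (\<lambda>x. f (x, 2*c*d/(c + d)) / x^2)
             + c*d/(d - c) * integral {c..d} (\<lambda>y. f (2*a*b/(a + b), y) / y^2))
         = a*b*c*d/((b - a)*(d - c))
           * integral {a..b} (\<lambda>x. integral {c..d} (\<lambda>y. f (x, y) / (x*y)^2))
       \<and> a*b*c*d/((b - a)*(d - c))
           * integral {a..b} (\<lambda>x. integral {c..d} (\<lambda>y. f (x, y) / (x*y)^2))
         = 1/4 * (a*b/(b - a) * integral {a..b} (\<lambda>x. f (x, c) / x^2)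
             + a*b/(b - a) * integral {a..b} (\<lambda>x. f (x, d) / x^2)
             + c*d/(d - c) * integral {c..d} (\<lambda>y. f (a, y) / y^2)
             + c*d/(d - c) * integral {c..d} (\<lambda>y. f (b, y) / y^2))
       \<and> 1/4 * (a*b/(b - a) * integral {a..b} (\<lambda>x. f (x, c) / x^2)
             + a*b/(b - a) * integral {a..b} (\<lambda>x. f (x, d) / x^2)
             + c*d/(d - c) * integral {c..d} (\<lambda>y. f (a, y) / y^2)
             + c*d/(d - c) * integral {c..d} (\<lambda>y. f (b, y) / y^2))
         = (f (a, c) + f (a, d) + f (b, c) + f (b, d)) / 4)"
proof -
  let ?one = "\<lambda>_ :: real \<times> real. 1 :: real"
  have one: "harmonically_convex_on_coordinates a b c d ?one"
    using assms
    by (auto simp: harmonically_convex_on_coordinates_def harmonically_convex_on_def is_interval_cc)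
  \<comment> \<open>For the constant function 1 both ends of the chain equal 1, so the inequalities
    already proved collapse to equalities and no integral has to be evaluated.\<close>
  have squeeze: "w = x \<and> x = y \<and> y = z \<and> z = u"
    if "w \<le> x" "x \<le> y" "y \<le> z" "z \<le> u" "u = w" for w x y z u :: real
    using that by simp
  have "(1 + 1 + 1 + 1) / 4 = (1 :: real)" by simp
  note eqs = squeeze[OF harmonic_hermite_hadamard_coordinates[OF one assms] this]
  show ?thesis
  proof (intro conjI allI impI exI[of _ ?one] one)
  qed ((erule harmonic_hermite_hadamard_coordinates[OF _ assms])+, (use eqs in blast)+)
qed

end
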